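(* Let $d\ge 1$ and let $\Lambda_d$ be a Gatzouras--Lalley sponge in $\mathbb{R}^d$ (as defined in the context). Then $$\dim_{\mathrm B}\Lambda_d=\max_{\mathbf{P}\in\mathcal{P}_{1,\ldots,d}}\ \sum_{n=1}^{d}C_n^{(d)}(\mathbf{P})\cdot H(\mathbf{p}_n),$$ where $\mathcal{P}_{1,\ldots,d}$ is the set of all vectors $\mathbf{P}=(\mathbf{p}_d;\mathbf{p}_{d-1};\ldots;\mathbf{p}_1)$ with each $\mathbf{p}_n$ a probability vector on $\mathcal{I}_n$, $H$ denotes entropy, and the coefficients $C_n^{(d)}(\mathbf{P})$ are defined in the context.
   Context: Box dimension: for bounded $\Lambda\subset\mathbb{R}^d$, $\dim_{\mathrm B}\Lambda=\lim_{\delta\to0}\frac{\log N_\delta(\Lambda)}{-\log\delta}$, where $N_\delta(\Lambda)$ is the minimum number of $d$-dimensional boxes of sidelength $\delta$ needed to cover $\Lambda$ (in general one takes liminf and limsup to get the lower and upper box dimensions; for the sets considered here the limit exists). Index sets: fix an integer $N\ge2$ and let $\mathcal{I}_1=\{1,\ldots,N\}$. Inductively for $2\le n\le d$: given $\mathcal{I}_{n-1}$, fix a positive integer $N(\underline{i})$ for each $\underline{i}\in\mathcal{I}_{n-1}$, let $\mathcal{I}(\underline{i})=\{1,\ldots,N(\underline{i})\}$ and $\mathcal{I}_n=\{(\underline{i},i_n):\underline{i}\in\mathcal{I}_{n-1},\ i_n\in\mathcal{I}(\underline{i})\}$. For $\underline{i}=(i_1,\ldots,i_n)\in\mathcal{I}_n$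 and $\ell\le n$ write $\underline{i}^{(\ell)}=(i_1,\ldots,i_\ell)\in\mathcal{I}_\ell$. Iterated function systems: for every $1\le n\le d$ and $\underline{i}\in\mathcal{I}_n$ numbers $0<\lambda(\underline{i})<1$ and $t(\underline{i})\in\mathbb{R}$ are given. For $1\le n\le d$ let $\mathcal{S}_n=\{S_{\underline{i}}:\mathbb{R}^n\to\mathbb{R}^n\}_{\underline{i}\in\mathcal{I}_n}$ with $$S_{\underline{i}}(\underline{x})=\mathrm{diag}\big(\lambda(\underline{i}^{(1)}),\ldots,\lambda(\underline{i}^{(n)})\big)\,\underline{x}+\big(t(\underline{i}^{(1)}),\ldots,t(\underline{i}^{(n)})\big)^{T}.$$ Without loss of generality it is assumed that $S_{\underline{i}}([0,1]^n)\subset[0,1]^n$. The attractor $\Lambda_n$ of $\mathcal{S}_n$ is the unique non-empty compact set with $\Lambda_n=\bigcup_{\underline{i}\in\mathcal{I}_n}S_{\underline{i}}(\Lambda_n)$. Gatzouras--Lalley sponge: the attractor $\Lambda_d$ of $\mathcal{S}_d$ is a Gatzouras--Lalley sponge in $\mathbb{R}^d$ if (1) (cuboidal open set condition) $S_{\underline{i}}((0,1)^d)\cap S_{\underline{j}}((0,1)^d)=\emptyset$ for every $\underline{i}\ne\underline{j}\in\mathcal{I}_d$; (2) (coordinate ordering condition) $0<\lambda(\underline{i}^{(d)})<\lambda(\underline{i}^{(d-1)})<\ldots<\lambda(\underline{i}^{(1)})<1$ for every $\underline{i}\in\mathcal{I}_d$. Entropy and Lyapunov exponents: for a probability vector $\mathbf{p}$,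 $H(\mathbf{p})=-\sum_i p_i\log p_i$ (with $0\log0=0$). For a probability vector $\mathbf{p}_m=(p_m(\underline{i}))_{\underline{i}\in\mathcal{I}_m}$ on $\mathcal{I}_m$ and $1\le n\le m$, $\chi_n(\mathbf{p}_m)=-\sum_{\underline{i}\in\mathcal{I}_m}p_m(\underline{i})\log\lambda(\underline{i}^{(n)})$. Coefficients: for $\mathbf{P}=(\mathbf{p}_d;\ldots;\mathbf{p}_1)\in\mathcal{P}_{1,\ldots,d}$, define recursively for $n=d,d-1,\ldots,1$ $$C_d^{(d)}(\mathbf{P})=\frac{1}{\chi_d(\mathbf{p}_d)},\qquad C_n^{(d)}(\mathbf{P})=\frac{1}{\chi_n(\mathbf{p}_n)}\Big(1-\sum_{m=n+1}^{d}C_m^{(d)}(\mathbf{P})\,\chi_n(\mathbf{p}_m)\Big).$$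
   Formalization: The cuboidal open set condition is required for the systems on R^n for every 1 ≤ n ≤ d, not only for n = d; with n = d alone overlapping columns are allowed and the formula fails (e.g. d=2, diag(0.6,0.3), translations (0,0), (0.4,0.5)). *)

theory Defs
  imports "HOL-Analysis.Analysis"
begin

text \<open>
  Points of R^n are elements of \<open>topspace (Euclidean_space n)\<close>, i.e. functions
  \<open>nat \<Rightarrow> real\<close> vanishing from index \<open>n\<close> on.  Coordinates are therefore numbered from \<open>0\<close>: the
  coordinate with index \<open>k\<close> is governed by the prefix of length \<open>Suc k\<close> of a word.
  Symbols \<open>(i\<^sub>1, \<dots>, i\<^sub>n)\<close> are lists of length \<open>n\<close>, and the truncation to the first \<open>l\<close> letters
  is \<open>take l\<close>.
\<close>

subsection \<open>Index sets and iterated function systems\<close>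

text \<open>The branching numbers are \<open>br\<close>; the number of first-level symbols is \<open>br []\<close>.\<close>

primrec index_set :: "(nat list \<Rightarrow> nat) \<Rightarrow> nat \<Rightarrow> nat list set" where
  "index_set br 0 = {[]}"
| "index_set br (Suc n) = {w @ [i] | w i. w \<in> index_set br n \<and> i \<in> {1..br w}}"

definition ifs_map ::
    "(nat list \<Rightarrow> real) \<Rightarrow> (nat list \<Rightarrow> real) \<Rightarrow> nat list \<Rightarrow> (nat \<Rightarrow> real) \<Rightarrow> (nat \<Rightarrow> real)" where
  "ifs_map lam t w x =
     (\<lambda>k. if k < length w then lam (take (Suc k) w) * x k + t (take (Suc k) w) else 0)"

definition closed_unit_cube :: "nat \<Rightarrow> (nat \<Rightarrow> real) set" where
  "closed_unit_cube n = {x \<in> topspace (Euclidean_space n). \<forall>k<n. 0 \<le> x k \<and> x k \<le> 1}"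

definition open_unit_cube :: "nat \<Rightarrow> (nat \<Rightarrow> real) set" where
  "open_unit_cube n = {x \<in> topspace (Euclidean_space n). \<forall>k<n. 0 < x k \<and> x k < 1}"

definition sponge_ifs ::
    "nat \<Rightarrow> (nat list \<Rightarrow> nat) \<Rightarrow> (nat list \<Rightarrow> real) \<Rightarrow> (nat list \<Rightarrow> real) \<Rightarrow> bool" where
  "sponge_ifs d br lam t \<longleftrightarrow>
     br [] \<ge> 2 \<and>
     (\<forall>n\<in>{1..<d}. \<forall>w\<in>index_set br n. br w \<ge> 1) \<and>
     (\<forall>n\<in>{1..d}. \<forall>w\<in>index_set br n. 0 < lam w \<and> lam w < 1) \<and>
     (\<forall>n\<in>{1..d}. \<forall>w\<in>index_set br n.
        ifs_map lam t w ` closed_unit_cube n \<subseteq> closed_unit_cube n)"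

definition is_attractor ::
    "nat \<Rightarrow> (nat list \<Rightarrow> nat) \<Rightarrow> (nat list \<Rightarrow> real) \<Rightarrow> (nat list \<Rightarrow> real) \<Rightarrow>
     (nat \<Rightarrow> real) set \<Rightarrow> bool" where
  "is_attractor n br lam t K \<longleftrightarrow>
     K \<noteq> {} \<and> compactin (Euclidean_space n) K \<and>
     K = (\<Union>w\<in>index_set br n. ifs_map lam t w ` K)"

subsection \<open>Gatzouras--Lalley sponges\<close>

definition cuboidal_osc ::
    "nat \<Rightarrow> (nat list \<Rightarrow> nat) \<Rightarrow> (nat list \<Rightarrow> real) \<Rightarrow> (nat list \<Rightarrow> real) \<Rightarrow> bool" where
  "cuboidal_osc n br lam t \<longleftrightarrow>
     (\<forall>v\<in>index_set br n. \<forall>w\<in>index_set br n. v \<noteq> w \<longrightarrow>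
        ifs_map lam t v ` open_unit_cube n \<inter> ifs_map lam t w ` open_unit_cube n = {})"

definition coordinate_ordering :: "nat \<Rightarrow> (nat list \<Rightarrow> nat) \<Rightarrow> (nat list \<Rightarrow> real) \<Rightarrow> bool" where
  "coordinate_ordering d br lam \<longleftrightarrow>
     (\<forall>w\<in>index_set br d.
        0 < lam (take d w) \<and>
        (\<forall>l\<in>{1..<d}. lam (take (Suc l) w) < lam (take l w)) \<and>
        lam (take 1 w) < 1)"

text \<open>
  The cuboidal open set condition is imposed on the system on R^n for every \<open>n \<le> d\<close>, as in the
  usual notion of Gatzouras--Lalley sets, whose coordinate projections are of the same kind.
  Imposing it only for \<open>n = d\<close> would admit overlapping columns, for which the dimension formula
  fails.  For example, let \<open>d = 2\<close>, let the two maps have linear part \<open>diag(0.6, 0.3)\<close>, and let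
  their translations be \<open>(0, 0)\<close> and \<open>(0.4, 0.5)\<close>.  The images of the open square are disjoint,
  but the box dimension is at most \<open>ln 4 / ln (1/0.3)\<close>, about \<open>1.151\<close>, whereas the formula gives
  \<open>ln 2 / ln (1/0.6)\<close>, about \<open>1.357\<close>.
\<close>

definition gatzouras_lalley_sponge ::
    "nat \<Rightarrow> (nat list \<Rightarrow> nat) \<Rightarrow> (nat list \<Rightarrow> real) \<Rightarrow> (nat list \<Rightarrow> real) \<Rightarrow>
     (nat \<Rightarrow> real) set \<Rightarrow> bool" where
  "gatzouras_lalley_sponge d br lam t K \<longleftrightarrow>
     is_attractor d br lam t K \<and>
     (\<forall>n\<in>{1..d}. cuboidal_osc n br lam t) \<and>
     coordinate_ordering d br lam"

subsection \<open>Box dimension\<close>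

definition is_box :: "nat \<Rightarrow> real \<Rightarrow> (nat \<Rightarrow> real) set \<Rightarrow> bool" where
  "is_box d \<delta> B \<longleftrightarrow>
     (\<exists>a. B = {x \<in> topspace (Euclidean_space d). \<forall>k<d. a k \<le> x k \<and> x k \<le> a k + \<delta>})"

definition covering_number :: "nat \<Rightarrow> real \<Rightarrow> (nat \<Rightarrow> real) set \<Rightarrow> nat" where
  "covering_number d \<delta> K =
     (LEAST m. \<exists>\<B>. finite \<B> \<and> card \<B> = m \<and> (\<forall>B\<in>\<B>. is_box d \<delta> B) \<and> K \<subseteq> \<Union>\<B>)"

text \<open>A relation rather than a function, so that it includes the existence of the limit.\<close>

definition has_box_dimension :: "nat \<Rightarrow> (nat \<Rightarrow> real) set \<Rightarrow> real \<Rightarrow> bool" where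
  "has_box_dimension d K s \<longleftrightarrow>
     ((\<lambda>\<delta>. ln (real (covering_number d \<delta> K)) / - ln \<delta>) \<longlongrightarrow> s) (at_right 0)"

subsection \<open>Entropy, Lyapunov exponents and coefficients\<close>

definition prob_vector :: "'a set \<Rightarrow> ('a \<Rightarrow> real) \<Rightarrow> bool" where
  "prob_vector A p \<longleftrightarrow> (\<forall>i\<in>A. 0 \<le> p i) \<and> (\<Sum>i\<in>A. p i) = 1"

text \<open>The convention \<open>0 log 0 = 0\<close> holds because the factor \<open>p i\<close> vanishes.\<close>

definition shannon_entropy :: "'a set \<Rightarrow> ('a \<Rightarrow> real) \<Rightarrow> real" where
  "shannon_entropy A p = - (\<Sum>i\<in>A. p i * ln (p i))"

text \<open>\<open>lyapunov br lam n m p\<close> is \<open>\<chi>\<^sub>n(p)\<close> for a probability vector \<open>p\<close> on \<open>index_set br m\<close>.\<close>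

definition lyapunov ::
    "(nat list \<Rightarrow> nat) \<Rightarrow> (nat list \<Rightarrow> real) \<Rightarrow> nat \<Rightarrow> nat \<Rightarrow> (nat list \<Rightarrow> real) \<Rightarrow> real" where
  "lyapunov br lam n m p = - (\<Sum>w\<in>index_set br m. p w * ln (lam (take n w)))"

definition prob_tuples :: "nat \<Rightarrow> (nat list \<Rightarrow> nat) \<Rightarrow> (nat \<Rightarrow> nat list \<Rightarrow> real) set" where
  "prob_tuples d br = {P. \<forall>n\<in>{1..d}. prob_vector (index_set br n) (P n)}"

text \<open>For \<open>n = d\<close> the sum is empty, which gives the initial value \<open>1 / \<chi>\<^sub>d(p\<^sub>d)\<close>.\<close>

function coeff_C ::
    "(nat list \<Rightarrow> nat) \<Rightarrow> (nat list \<Rightarrow> real) \<Rightarrow> nat \<Rightarrow> (nat \<Rightarrow> nat list \<Rightarrow> real) \<Rightarrow> nat \<Rightarrow> real" where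
  "coeff_C br lam d P n =
     1 / lyapunov br lam n n (P n) *
     (1 - (\<Sum>m\<in>{n+1..d}. coeff_C br lam d P m * lyapunov br lam n m (P m)))"
  by pat_completeness auto
termination
  by (relation "Wellfounded.measure (\<lambda>(br, lam, d, P, n). d - n)") auto

declare coeff_C.simps [simp del]

definition dimension_functional ::
    "nat \<Rightarrow> (nat list \<Rightarrow> nat) \<Rightarrow> (nat list \<Rightarrow> real) \<Rightarrow> (nat \<Rightarrow> nat list \<Rightarrow> real) \<Rightarrow> real" where
  "dimension_functional d br lam P =
     (\<Sum>n=1..d. coeff_C br lam d P n * shannon_entropy (index_set br n) (P n))"

end

theory Submission
  imports Defs
begin

text \<open>
  Choose successively exponents \<open>\<sigma> l \<ge> 0\<close> such that, for every \<open>n \<le> d\<close>, the weights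
  \<open>\<Prod>l<n. lam (take (Suc l) w) powr \<sigma> l\<close> of the words \<open>w\<close> in \<open>index_set br n\<close> add up to \<open>1\<close>.  Both
  sides of the formula equal \<open>\<Sum>l<d. \<sigma> l\<close>.

  For the maximum, Gibbs' inequality gives \<open>H(p\<^sub>n) \<le> \<Sum>l<n. \<sigma> l * \<chi>\<^sub>l\<^sub>+\<^sub>1(p\<^sub>n)\<close>, with equality for the weights
  themselves.  The coefficients are nonnegative by the coordinate ordering, and their recursion says
  \<open>(\<Sum>m=n..d. C\<^sub>m * \<chi>\<^sub>n(p\<^sub>m)) = 1\<close>, so the bounds add up to \<open>\<Sum>l<d. \<sigma> l\<close>.

  For the box dimension, cut the cube into approximate cubes, all of whose sides are comparable to
  \<open>\<delta>\<close>: apply the maps of the \<open>n\<close>-dimensional system as long as the \<open>n\<close>-th side exceeds \<open>\<delta>\<close>, then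
  forget that coordinate.  Since the weights add up to \<open>1\<close> at every step, the number of approximate
  cubes is comparable to \<open>\<delta>\<close> to the power \<open>- (\<Sum>l<d. \<sigma> l)\<close>.  They have disjoint interiors, so that
  rounding their corners to a lattice is injective, and a box of side \<open>\<delta>\<close> meets boundedly many.
\<close>

section \<open>Words and their prefixes\<close>

lemma length_index_set: "w \<in> index_set br n \<Longrightarrow> length w = n"
  by (induction n arbitrary: w) auto

lemma index_set_Suc_image:
  "index_set br (Suc n) = (\<lambda>(w, i). w @ [i]) ` (SIGMA w:index_set br n. {1..br w})"
  by auto

lemma finite_index_set [simp]: "finite (index_set br n)"
  by (induction n) (simp_all add: index_set_Suc_image del: index_set.simps(2))

lemma take_index_set:
  assumes "w \<in> index_set br n" and "m \<le> n"
  shows "take m w \<in> index_set br m"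
  using assms
proof (induction n arbitrary: w)
  case (Suc n)
  show ?case
  proof (cases "m = Suc n")
    case True
    then show ?thesis
      using Suc.prems length_index_set[OF Suc.prems(1)] by simp
  next
    case False
    obtain v i where v: "w = v @ [i]" "v \<in> index_set br n"
      using Suc.prems by auto
    have "take m w = take m v"
      using False Suc.prems v length_index_set[OF v(2)] by simp
    then show ?thesis
      using Suc v False by simp
  qed
qed simp

lemma sum_index_set_Suc:
  "sum f (index_set br (Suc n)) = (\<Sum>w\<in>index_set br n. \<Sum>i=1..br w. f (w @ [i]))"
proof -
  have "inj_on (\<lambda>(w, i). w @ [i]) (SIGMA w:index_set br n. {1..br w})"
    by (auto simp: inj_on_def)
  then have "sum f (index_set br (Suc n)) = (\<Sum>(w, i)\<in>(SIGMA w:index_set br n. {1..br w}). f (w @ [i]))"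
    unfolding index_set_Suc_image by (simp add: sum.reindex case_prod_unfold)
  then show ?thesis
    by (simp add: sum.Sigma)
qed

text \<open>The length \<open>n\<close> is a separate argument, so that a longer word also carries
  the weight of its prefix, and \<open>weight lam \<sigma>\<close> has the type of a tuple of
  probability vectors.\<close>

definition weight :: "(nat list \<Rightarrow> real) \<Rightarrow> (nat \<Rightarrow> real) \<Rightarrow> nat \<Rightarrow> nat list \<Rightarrow> real" where
  "weight lam \<sigma> n w = (\<Prod>l<n. lam (take (Suc l) w) powr \<sigma> l)"

text \<open>Apply \<open>ln x \<le> x - 1\<close> at \<open>x = q i / p i\<close>, multiply by
  \<open>p i\<close> and sum; both vectors have total mass \<open>1\<close>, so the right side
  vanishes.\<close>

lemma gibbs_inequality:
  assumes "finite A" and "prob_vector A p" and "\<And>i. i \<in> A \<Longrightarrow> 0 < q i" and "sum q A = 1"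
  shows "shannon_entropy A p \<le> - (\<Sum>i\<in>A. p i * ln (q i))"
proof -
  have "p i * ln (q i) - p i * ln (p i) \<le> q i - p i" if "i \<in> A" for i
  proof (cases "p i = 0")
    case True
    then show ?thesis using assms(3)[OF that] by simp
  next
    case False
    then have "0 < p i"
      using assms(2) that by (auto simp: prob_vector_def order_less_le)
    then have "p i * ln (q i / p i) \<le> p i * (q i / p i - 1)"
      using assms(3)[OF that] by (intro mult_left_mono ln_le_minus_one) auto
    also have "\<dots> = q i - p i"
      using \<open>0 < p i\<close> by (simp add: field_simps)
    finally show ?thesis
      using \<open>0 < p i\<close> assms(3)[OF that] by (simp add: ln_div algebra_simps)
  qed
  then have "(\<Sum>i\<in>A. p i * ln (q i) - p i * ln (p i)) \<le> (\<Sum>i\<in>A. q i - p i)"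
    by (rule sum_mono)
  also have "\<dots> = 0"
    using assms by (simp add: sum_subtractf prob_vector_def)
  finally show ?thesis
    by (simp add: sum_subtractf shannon_entropy_def)
qed

section \<open>Ratios, translations and separation of cylinders\<close>

locale gl_sponge =
  fixes d :: nat
    and br :: "nat list \<Rightarrow> nat"
    and lam t :: "nat list \<Rightarrow> real"
    and \<Lambda> :: "(nat \<Rightarrow> real) set"
  assumes d_pos: "d \<ge> 1"
    and sponge: "sponge_ifs d br lam t"
    and gatzouras_lalley: "gatzouras_lalley_sponge d br lam t \<Lambda>"
begin

lemma br_pos: "n < d \<Longrightarrow> w \<in> index_set br n \<Longrightarrow> 1 \<le> br w"
  using sponge by (cases n) (auto simp: sponge_ifs_def simp del: index_set.simps(2))

text \<open>Branching numbers are positive, so the letter \<open>1\<close> can always be appended.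
  This carries facts known only for words of length \<open>d\<close> over to prefixes.\<close>

lemma index_set_extend:
  assumes "m \<le> n" and "n \<le> d" and "v \<in> index_set br m"
  shows "\<exists>w\<in>index_set br n. take m w = v"
  using assms
proof (induction n rule: dec_induct)
  case base
  then show ?case using length_index_set by fastforce
next
  case (step n)
  then obtain w where w: "w \<in> index_set br n" "take m w = v" by auto
  then have "w @ [1] \<in> index_set br (Suc n)"
    using br_pos[of n w] step by auto
  moreover have "take m (w @ [1]) = v"
    using w step length_index_set[OF w(1)] by simp
  ultimately show ?case by blast
qed

context
  fixes n w assumes n: "n \<le> d" and w: "w \<in> index_set br n"
begin

lemma lam_pos: "l < n \<Longrightarrow> 0 < lam (take (Suc l) w)"
  and lam_less_1: "l < n \<Longrightarrow> lam (take (Suc l) w) < 1"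
  using sponge take_index_set[OF w, of "Suc l"] n
  by (auto simp: sponge_ifs_def simp del: index_set.simps(2))

text \<open>The ordering condition speaks of words of length \<open>d\<close>, so \<open>w\<close>
  is first extended to such a word.\<close>

lemma lam_antimono:
  assumes "l \<le> k" and "k < n"
  shows "lam (take (Suc k) w) \<le> lam (take (Suc l) w)"
  using assms
proof (induction k rule: dec_induct)
  case (step k)
  obtain v where v: "v \<in> index_set br d" "take n v = w"
    using index_set_extend n w by blast
  have "lam (take (Suc (Suc k)) v) < lam (take (Suc k) v)"
    using gatzouras_lalley v step n
    by (auto simp: gatzouras_lalley_sponge_def coordinate_ordering_def)
  moreover have "take (Suc (Suc k)) v = take (Suc (Suc k)) w" "take (Suc k) v = take (Suc k) w"
    using v step by (auto simp: min_def)
  ultimately show ?case using step by auto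
qed simp

text \<open>The map of \<open>w\<close> sends the opposite corners \<open>0\<close> and
  \<open>(1, ..., 1)\<close> of the cube into the cube.\<close>

lemma t_nonneg: "l < n \<Longrightarrow> 0 \<le> t (take (Suc l) w)"
  and t_add_lam_le: "l < n \<Longrightarrow> t (take (Suc l) w) + lam (take (Suc l) w) \<le> 1"
proof -
  assume l: "l < n"
  have *: "ifs_map lam t w ` closed_unit_cube n \<subseteq> closed_unit_cube n"
    using sponge n w l by (auto simp: sponge_ifs_def)
  have "(\<lambda>k. 0) \<in> closed_unit_cube n" "(\<lambda>k. if k < n then 1 else 0) \<in> closed_unit_cube n"
    by (auto simp: closed_unit_cube_def topspace_Euclidean_space)
  then have "ifs_map lam t w (\<lambda>k. 0) \<in> closed_unit_cube n"
    "ifs_map lam t w (\<lambda>k. if k < n then 1 else 0) \<in> closed_unit_cube n"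
    using * by blast+
  then show "0 \<le> t (take (Suc l) w)" "t (take (Suc l) w) + lam (take (Suc l) w) \<le> 1"
    using l length_index_set[OF w] by (auto simp: closed_unit_cube_def ifs_map_def)
qed

lemma weight_pos: "0 < weight lam \<sigma> n w"
  unfolding weight_def using lam_pos by (intro prod_pos) (fastforce simp: powr_gt_zero)

lemma ln_weight: "ln (weight lam \<sigma> n w) = (\<Sum>l<n. \<sigma> l * ln (lam (take (Suc l) w)))"
proof -
  have "ln (weight lam \<sigma> n w) = (\<Sum>l<n. ln (lam (take (Suc l) w) powr \<sigma> l))"
    unfolding weight_def using lam_pos by (intro ln_prod) fastforce+
  then show ?thesis by (simp add: ln_powr)
qed

end

text \<open>If the two image intervals overlapped in every coordinate, the point formed by the
  midpoints of the overlaps would lie in both open images, against the open set condition in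
  dimension \<open>n\<close>.\<close>

lemma separated_intervals:
  assumes "n \<in> {1..d}" and "v \<in> index_set br n" "w \<in> index_set br n" "v \<noteq> w"
  shows "\<exists>l<n. t (take (Suc l) v) + lam (take (Suc l) v) \<le> t (take (Suc l) w) \<or>
               t (take (Suc l) w) + lam (take (Suc l) w) \<le> t (take (Suc l) v)"
proof (rule ccontr)
  assume contra: "\<not> ?thesis"
  define lo where "lo l = max (t (take (Suc l) v)) (t (take (Suc l) w))" for l
  define hi where "hi l = min (t (take (Suc l) v) + lam (take (Suc l) v))
                              (t (take (Suc l) w) + lam (take (Suc l) w))" for l
  define x where "x l = (if l < n then (lo l + hi l) / 2 else 0)" for l
  have nd: "n \<le> d" using assms by simp
  have lohi: "lo l < hi l" if "l < n" for l
    using contra that lam_pos[OF nd assms(2) that] lam_pos[OF nd assms(3) that]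
    by (auto simp: lo_def hi_def not_le)
  have mem: "x \<in> ifs_map lam t u ` open_unit_cube n" if u: "u = v \<or> u = w" for u
  proof
    define y where "y l = (if l < n then (x l - t (take (Suc l) u)) / lam (take (Suc l) u) else 0)" for l
    have u': "u \<in> index_set br n" using u assms by auto
    note pos = lam_pos[OF nd u']
    have "t (take (Suc l) u) < x l \<and> x l < t (take (Suc l) u) + lam (take (Suc l) u)" if "l < n" for l
      using lohi[OF that] u that by (auto simp: x_def lo_def hi_def)
    then show "y \<in> open_unit_cube n"
      using pos by (auto simp: open_unit_cube_def topspace_Euclidean_space y_def field_simps)
    show "x = ifs_map lam t u y"
    proof
      fix l
      show "x l = ifs_map lam t u y l"
        using pos[of l] length_index_set[OF u'] by (auto simp: y_def ifs_map_def x_def)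
    qed
  qed
  have "ifs_map lam t v ` open_unit_cube n \<inter> ifs_map lam t w ` open_unit_cube n = {}"
    using gatzouras_lalley assms by (auto simp: gatzouras_lalley_sponge_def cuboidal_osc_def)
  then show False using mem by blast
qed

section \<open>The attractor and its coordinates\<close>

lemma attractor: "\<Lambda> \<noteq> {}" "compactin (Euclidean_space d) \<Lambda>"
  and attractor_unfold: "\<Lambda> = (\<Union>w\<in>index_set br d. ifs_map lam t w ` \<Lambda>)"
  using gatzouras_lalley by (auto simp: gatzouras_lalley_sponge_def is_attractor_def)

lemma attractor_cases:
  assumes "x \<in> \<Lambda>"
  obtains w y where "w \<in> index_set br d" "y \<in> \<Lambda>" "x = ifs_map lam t w y"
  using assms attractor_unfold by blast

lemma ifs_map_attractor:
  "w \<in> index_set br d \<Longrightarrow> y \<in> \<Lambda> \<Longrightarrow> ifs_map lam t w y \<in> \<Lambda>"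
  using attractor_unfold by blast

lemma ifs_map_apply:
  "w \<in> index_set br d \<Longrightarrow> l < d \<Longrightarrow>
    ifs_map lam t w x l = lam (take (Suc l) w) * x l + t (take (Suc l) w)"
  using length_index_set by (auto simp: ifs_map_def)

lemma attractor_topspace: "\<Lambda> \<subseteq> topspace (Euclidean_space d)"
  using attractor(2) compactin_subset_topspace by blast

lemma compact_coordinate_image: "compact ((\<lambda>x. x l) ` \<Lambda>)"
proof -
  have "continuous_map (Euclidean_space d) euclideanreal (\<lambda>x. x l)"
    unfolding Euclidean_space_def
    by (intro continuous_map_from_subtopology continuous_map_product_projection) auto
  from image_compactin[OF attractor(2) this] show ?thesis by simp
qed

text \<open>By compactness each coordinate attains its maximum \<open>M\<close> on
  \<open>\<Lambda>\<close>. The maximal point is an image under some map, so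
  \<open>M \<le> lam * M + t \<le> lam * M + (1 - lam)\<close> and hence \<open>M \<le> 1\<close>.
  The minimum is treated in the same way.\<close>

lemma attractor_unit_interval:
  assumes "x \<in> \<Lambda>" and l: "l < d"
  shows "0 \<le> x l" and "x l \<le> 1"
proof -
  note ne = attractor(1)
  obtain y where y: "y \<in> \<Lambda>" "\<And>z. z \<in> \<Lambda> \<Longrightarrow> z l \<le> y l"
    using compact_attains_sup[OF compact_coordinate_image[of l]] ne by auto
  obtain w z where "w \<in> index_set br d" "z \<in> \<Lambda>" "y = ifs_map lam t w z"
    using attractor_cases[OF y(1)] .
  then have w: "w \<in> index_set br d" "y l = lam (take (Suc l) w) * z l + t (take (Suc l) w)" "z l \<le> y l"
    using y(2) ifs_map_apply l by auto
  note pos = lam_pos[OF order_refl w(1) l] lam_less_1[OF order_refl w(1) l]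
    t_nonneg[OF order_refl w(1) l] t_add_lam_le[OF order_refl w(1) l]
  have "y l \<le> lam (take (Suc l) w) * y l + (1 - lam (take (Suc l) w))"
    using w pos mult_left_mono[OF w(3), of "lam (take (Suc l) w)"] by linarith
  then have "(1 - lam (take (Suc l) w)) * y l \<le> (1 - lam (take (Suc l) w)) * 1"
    by (simp add: algebra_simps)
  then have "y l \<le> 1" using pos by (simp only: mult_le_cancel_left_pos diff_gt_0_iff_gt)
  then show "x l \<le> 1" using y(2)[OF assms(1)] by simp
next
  note ne = attractor(1)
  obtain y where y: "y \<in> \<Lambda>" "\<And>z. z \<in> \<Lambda> \<Longrightarrow> y l \<le> z l"
    using compact_attains_inf[OF compact_coordinate_image[of l]] ne by auto
  obtain w z where "w \<in> index_set br d" "z \<in> \<Lambda>" "y = ifs_map lam t w z"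
    using attractor_cases[OF y(1)] .
  then have w: "w \<in> index_set br d" "y l = lam (take (Suc l) w) * z l + t (take (Suc l) w)" "y l \<le> z l"
    using y(2) ifs_map_apply l by auto
  note pos = lam_pos[OF order_refl w(1) l] lam_less_1[OF order_refl w(1) l]
    t_nonneg[OF order_refl w(1) l]
  have "y l \<ge> lam (take (Suc l) w) * y l"
    using w pos mult_left_mono[OF w(3), of "lam (take (Suc l) w)"] by linarith
  then have "0 \<le> (1 - lam (take (Suc l) w)) * y l"
    by (simp add: algebra_simps)
  then have "0 \<le> y l" using pos by (simp add: zero_le_mult_iff)
  then show "0 \<le> x l" using y(2)[OF assms(1)] by simp
qed

subsection \<open>The dimension exponents\<close>

text \<open>The exponents are found one at a time. Given the first \<open>n\<close>, the sum of the
  weights at length \<open>n + 1\<close> is a continuous function \<open>g\<close> of the next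
  exponent, at least \<open>1\<close> at \<open>0\<close> and tending to \<open>0\<close> at
  infinity, so it takes the value \<open>1\<close>.\<close>

lemma exponents_exist_upto:
  "n \<le> d \<Longrightarrow> \<exists>\<sigma>. (\<forall>l. 0 \<le> \<sigma> l) \<and> (\<forall>m\<le>n. sum (weight lam \<sigma> m) (index_set br m) = 1)"
proof (induction n)
  case 0
  show ?case by (intro exI[of _ "\<lambda>_. 0"]) (simp add: weight_def)
next
  case (Suc n)
  then obtain \<sigma> where \<sigma>: "\<And>l. 0 \<le> \<sigma> l" "\<And>m. m \<le> n \<Longrightarrow> sum (weight lam \<sigma> m) (index_set br m) = 1"
    by auto
  let ?I = "index_set br (Suc n)"
  define g where "g x = (\<Sum>w\<in>?I. weight lam \<sigma> n w * lam w powr x)" for x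
  have full: "take (Suc n) w = w" if "w \<in> ?I" for w
    using length_index_set[OF that] by simp
  have lam: "0 < lam w" "lam w < 1" if "w \<in> ?I" for w
    using lam_pos[OF Suc.prems that, of n] lam_less_1[OF Suc.prems that, of n] full[OF that] by auto
  have "1 = (\<Sum>w\<in>index_set br n. weight lam \<sigma> n w)"
    using \<sigma>(2)[of n] by simp
  also have "\<dots> \<le> (\<Sum>w\<in>index_set br n. real (br w) * weight lam \<sigma> n w)"
  proof (rule sum_mono)
    fix w assume w: "w \<in> index_set br n"
    have "1 \<le> real (br w)" "0 \<le> weight lam \<sigma> n w"
      using br_pos[OF _ w] Suc.prems weight_pos[OF _ w, of \<sigma>] by auto
    then show "weight lam \<sigma> n w \<le> real (br w) * weight lam \<sigma> n w"
      using mult_right_mono[of 1 "real (br w)" "weight lam \<sigma> n w"] by simp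
  qed
  \<comment> \<open>Each word \<open>w\<close> of length \<open>n\<close> has \<open>br w\<close>
    children, all carrying the weight of \<open>w\<close>.\<close>
  also have "\<dots> = (\<Sum>w\<in>?I. weight lam \<sigma> n w)"
    unfolding sum_index_set_Suc
    by (intro sum.cong refl) (simp add: weight_def length_index_set)
  also have "\<dots> = g 0"
    unfolding g_def using lam(1) by (intro sum.cong refl) (fastforce simp del: index_set.simps(2))
  finally have g0: "1 \<le> g 0" .
  have "(g \<longlongrightarrow> (\<Sum>w\<in>?I. weight lam \<sigma> n w * 0)) at_top"
    unfolding g_def
  proof (intro tendsto_sum tendsto_mult tendsto_const)
    fix w assume w: "w \<in> ?I"
    have "((\<lambda>x. exp (x * ln (lam w))) \<longlongrightarrow> 0) at_top"
    proof (rule filterlim_compose[OF exp_at_bot])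
      show "filterlim (\<lambda>x. x * ln (lam w)) at_bot at_top"
        using lam[OF w] by (subst mult.commute, intro filterlim_tendsto_neg_mult_at_bot[OF tendsto_const] filterlim_ident) auto
    qed
    then show "((\<lambda>x. lam w powr x) \<longlongrightarrow> 0) at_top"
      using lam[OF w] by (simp add: powr_def)
  qed
  then have "(g \<longlongrightarrow> 0) at_top" by simp
  then have "eventually (\<lambda>x. g x < 1) at_top"
    by (rule order_tendstoD) simp
  then have "eventually (\<lambda>x. 0 \<le> x \<and> g x < 1) at_top"
    using eventually_ge_at_top[of 0] by eventually_elim simp
  then obtain X where X: "0 \<le> X" "g X < 1"
    by (auto simp: eventually_at_top_linorder)
  have "continuous_on {0..X} g"
    unfolding g_def using lam(1) by (intro continuous_intros) (fastforce simp del: index_set.simps(2))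
  then obtain x where x: "0 \<le> x" "g x = 1"
    using IVT2'[of g X 1 0] g0 X by auto
  let ?\<sigma> = "\<sigma>(n := x)"
  \<comment> \<open>Changing the exponent with index \<open>n\<close> leaves the weights of length
    at most \<open>n\<close> untouched.\<close>
  have same: "weight lam ?\<sigma> m w = weight lam \<sigma> m w" if "m \<le> n" for m w
    unfolding weight_def using that by (intro prod.cong) auto
  have "sum (weight lam ?\<sigma> (Suc n)) ?I = g x"
    unfolding g_def
  proof (rule sum.cong[OF refl])
    fix w assume w: "w \<in> ?I"
    have "weight lam ?\<sigma> (Suc n) w = weight lam ?\<sigma> n w * lam w powr x"
      using full[OF w] by (simp add: weight_def)
    then show "weight lam ?\<sigma> (Suc n) w = weight lam \<sigma> n w * lam w powr x"
      by (simp add: same)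
  qed
  then have "sum (weight lam ?\<sigma> m) (index_set br m) = 1" if "m \<le> Suc n" for m
    using that \<sigma>(2) x same by (cases "m = Suc n") auto
  moreover have "0 \<le> ?\<sigma> l" for l
    using \<sigma>(1) x by simp
  ultimately show ?case by blast
qed

definition \<sigma> :: "nat \<Rightarrow> real" where
  "\<sigma> = (SOME s. (\<forall>l. 0 \<le> s l) \<and> (\<forall>m\<le>d. sum (weight lam s m) (index_set br m) = 1))"

lemma \<sigma>_nonneg: "0 \<le> \<sigma> l"
  and sum_weight: "m \<le> d \<Longrightarrow> sum (weight lam \<sigma> m) (index_set br m) = 1"
  using someI_ex[OF exponents_exist_upto[OF order_refl]] unfolding \<sigma>_def by auto

subsection \<open>The variational principle\<close>

text \<open>All ratios are below \<open>1\<close> and some \<open>p w\<close> is nonzero. This makes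
  the division in \<open>coeff_C\<close> meaningful.\<close>

lemma lyapunov_pos:
  assumes "n \<in> {1..m}" and "m \<le> d" and "prob_vector (index_set br m) p"
  shows "0 < lyapunov br lam n m p"
proof -
  have neg: "ln (lam (take n w)) < 0" if "w \<in> index_set br m" for w
    using lam_pos[OF assms(2) that, of "n - 1"] lam_less_1[OF assms(2) that, of "n - 1"] assms(1)
    by auto
  have p: "\<And>w. w \<in> index_set br m \<Longrightarrow> 0 \<le> p w" "sum p (index_set br m) = 1"
    using assms(3) by (auto simp: prob_vector_def)
  obtain w where w: "w \<in> index_set br m" "p w \<noteq> 0"
    using p(2) by (metis sum.neutral zero_neq_one)
  have "0 < (\<Sum>w\<in>index_set br m. - (p w * ln (lam (take n w))))"
  proof (rule sum_pos2[OF finite_index_set w(1)])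
    show "0 < - (p w * ln (lam (take n w)))"
      using w p(1)[OF w(1)] neg[OF w(1)] by (simp add: mult_less_0_iff)
    show "0 \<le> - (p i * ln (lam (take n i)))" if "i \<in> index_set br m" for i
      using p(1)[OF that] neg[OF that] by (simp add: mult_le_0_iff)
  qed
  then show ?thesis by (simp add: lyapunov_def sum_negf)
qed

lemma lyapunov_mono:
  assumes "n \<in> {1..<m}" and "m \<le> d" and "prob_vector (index_set br m) p"
  shows "lyapunov br lam n m p \<le> lyapunov br lam (Suc n) m p"
  unfolding lyapunov_def neg_le_iff_le
proof (intro sum_mono mult_left_mono)
  fix w assume w: "w \<in> index_set br m"
  show "0 \<le> p w" using w assms(3) by (auto simp: prob_vector_def)
  have "lam (take (Suc n) w) \<le> lam (take n w)" "0 < lam (take (Suc n) w)"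
    using lam_antimono[OF assms(2) w, of "n - 1" n] lam_pos[OF assms(2) w, of n] assms(1) by auto
  then show "ln (lam (take (Suc n) w)) \<le> ln (lam (take n w))" by simp
qed

text \<open>The logarithm of a weight is linear in the exponents, so the right side of Gibbs'
  inequality becomes a combination of Lyapunov exponents.\<close>

lemma cross_entropy_weight:
  assumes "n \<le> d"
  shows "- (\<Sum>w\<in>index_set br n. p w * ln (weight lam \<sigma> n w)) =
    (\<Sum>l<n. \<sigma> l * lyapunov br lam (Suc l) n p)"
proof -
  have "(\<Sum>w\<in>index_set br n. p w * ln (weight lam \<sigma> n w)) =
    (\<Sum>w\<in>index_set br n. \<Sum>l<n. \<sigma> l * (p w * ln (lam (take (Suc l) w))))"
    by (intro sum.cong refl) (simp add: ln_weight[OF assms] sum_distrib_left mult_ac)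
  also have "\<dots> = (\<Sum>l<n. \<sigma> l * (\<Sum>w\<in>index_set br n. p w * ln (lam (take (Suc l) w))))"
    by (subst sum.swap) (simp add: sum_distrib_left)
  finally show ?thesis
    by (simp add: lyapunov_def sum_negf)
qed

context
  fixes P assumes P: "P \<in> prob_tuples d br"
begin

lemma prob_vector_component: "n \<in> {1..d} \<Longrightarrow> prob_vector (index_set br n) (P n)"
  using P by (simp add: prob_tuples_def)

text \<open>Multiplying the recursion by the positive number
  \<open>lyapunov br lam n n (P n)\<close> turns it into the summand with
  \<open>m = n\<close>.\<close>

lemma sum_coeff_C_lyapunov:
  assumes "n \<in> {1..d}"
  shows "(\<Sum>m=n..d. coeff_C br lam d P m * lyapunov br lam n m (P m)) = 1"
proof -
  have "0 < lyapunov br lam n n (P n)"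
    using lyapunov_pos prob_vector_component assms by simp
  then have "coeff_C br lam d P n * lyapunov br lam n n (P n) =
    1 - (\<Sum>m\<in>{n+1..d}. coeff_C br lam d P m * lyapunov br lam n m (P m))"
    by (subst coeff_C.simps) simp
  then show ?thesis
    using assms by (simp add: sum.atLeast_Suc_atMost)
qed

text \<open>Downward induction on \<open>n\<close>. The later coefficients are nonnegative and
  Lyapunov exponents grow with the coordinate, so replacing \<open>n\<close> by \<open>Suc n\<close>
  only increases the sum, and then it equals \<open>1\<close>.\<close>

lemma coeff_C_nonneg:
  assumes "1 \<le> n" and "n \<le> d"
  shows "0 \<le> coeff_C br lam d P n"
  using assms(2,1)
proof (induction n rule: measure_induct_rule[where f = "\<lambda>n. d - n"])
  case (less n)
  have "(\<Sum>m\<in>{n+1..d}. coeff_C br lam d P m * lyapunov br lam n m (P m)) \<le> 1"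
  proof (cases "n = d")
    case False
    have "(\<Sum>m\<in>{n+1..d}. coeff_C br lam d P m * lyapunov br lam n m (P m)) \<le>
      (\<Sum>m\<in>{n+1..d}. coeff_C br lam d P m * lyapunov br lam (Suc n) m (P m))"
      using less prob_vector_component
      by (intro sum_mono mult_left_mono lyapunov_mono) auto
    also have "\<dots> = 1"
      using sum_coeff_C_lyapunov[of "Suc n"] less.prems False by simp
    finally show ?thesis .
  qed simp
  moreover have "0 < lyapunov br lam n n (P n)"
    using lyapunov_pos prob_vector_component less.prems by simp
  ultimately show ?case by (subst coeff_C.simps) simp
qed

text \<open>After exchanging the sums, the factor of \<open>\<sigma> l\<close> is the normalised sum
  belonging to coordinate \<open>Suc l\<close>.\<close>

lemma sum_coeff_C_cross_entropy:
  "(\<Sum>n=1..d. coeff_C br lam d P n * (\<Sum>l<n. \<sigma> l * lyapunov br lam (Suc l) n (P n))) = (\<Sum>l<d. \<sigma> l)"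
proof -
  let ?g = "\<lambda>l n. \<sigma> l * (coeff_C br lam d P n * lyapunov br lam (Suc l) n (P n))"
  have "(\<Sum>n=1..d. coeff_C br lam d P n * (\<Sum>l<n. \<sigma> l * lyapunov br lam (Suc l) n (P n))) =
    (\<Sum>n=1..d. \<Sum>l\<in>{l. l \<in> {..<d} \<and> l < n}. ?g l n)"
    by (intro sum.cong refl) (auto simp: sum_distrib_left mult_ac intro!: sum.cong)
  also have "\<dots> = (\<Sum>l<d. \<Sum>n\<in>{n. n \<in> {1..d} \<and> l < n}. ?g l n)"
    by (rule sum.swap_restrict) auto
  also have "\<dots> = (\<Sum>l<d. \<sigma> l * (\<Sum>n=Suc l..d. coeff_C br lam d P n * lyapunov br lam (Suc l) n (P n)))"
    by (intro sum.cong refl) (auto simp: sum_distrib_left intro!: sum.cong)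
  also have "\<dots> = (\<Sum>l<d. \<sigma> l)"
    by (intro sum.cong refl) (simp add: sum_coeff_C_lyapunov)
  finally show ?thesis .
qed

lemma dimension_functional_le: "dimension_functional d br lam P \<le> (\<Sum>l<d. \<sigma> l)"
proof -
  have "dimension_functional d br lam P \<le>
    (\<Sum>n=1..d. coeff_C br lam d P n * (\<Sum>l<n. \<sigma> l * lyapunov br lam (Suc l) n (P n)))"
    unfolding dimension_functional_def
  proof (intro sum_mono mult_left_mono)
    fix n assume n: "n \<in> {1..d}"
    then show "0 \<le> coeff_C br lam d P n" by (simp add: coeff_C_nonneg)
    show "shannon_entropy (index_set br n) (P n) \<le> (\<Sum>l<n. \<sigma> l * lyapunov br lam (Suc l) n (P n))"
      using gibbs_inequality[OF finite_index_set prob_vector_component[OF n], of "weight lam \<sigma> n"]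
        weight_pos sum_weight n cross_entropy_weight[of n "P n"] by auto
  qed
  then show ?thesis by (simp only: sum_coeff_C_cross_entropy)
qed

end

lemma weight_prob_tuples: "weight lam \<sigma> \<in> prob_tuples d br"
  by (auto simp: prob_tuples_def prob_vector_def sum_weight intro: less_imp_le[OF weight_pos])

text \<open>The entropy of the weights is their cross entropy with themselves, so Gibbs' bound is an
  equality here.\<close>

lemma dimension_functional_weight: "dimension_functional d br lam (weight lam \<sigma>) = (\<Sum>l<d. \<sigma> l)"
proof -
  note W = weight_prob_tuples
  show ?thesis
    unfolding dimension_functional_def shannon_entropy_def
    by (subst sum_coeff_C_cross_entropy[OF W, symmetric], intro sum.cong refl)
      (simp add: cross_entropy_weight)
qed

subsection \<open>Approximate cubes\<close>

text \<open>
  The sets covered are the images of \<open>\<Lambda>\<close> under \<open>x \<mapsto> (a l + r l * x l)\<^sub>l\<close>, seen in the first \<open>n\<close>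
  coordinates only; a pair \<open>(b, s)\<close> stands for the cuboid with lower corner \<open>b\<close> and sides \<open>s\<close>.
\<close>

definition approx_cubes ::
    "real \<Rightarrow> real \<Rightarrow> nat \<Rightarrow> (nat \<Rightarrow> real) \<Rightarrow> (nat \<Rightarrow> real) \<Rightarrow> ((nat \<Rightarrow> real) \<times> (nat \<Rightarrow> real)) set \<Rightarrow> bool"
where
  "approx_cubes \<eta> \<delta> n a r F \<longleftrightarrow> finite F \<and>
     (\<forall>b s l. (b, s) \<in> F \<longrightarrow> l < n \<longrightarrow> \<eta> \<le> s l \<and> s l \<le> \<delta> \<and> a l \<le> b l \<and> b l + s l \<le> a l + r l) \<and>
     (\<forall>b s. (b, s) \<in> F \<longrightarrow>
        (\<exists>x\<in>\<Lambda>. \<forall>l<n. b l \<le> a l + r l * x l \<and> a l + r l * x l \<le> b l + s l)) \<and>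
     (\<forall>b s b' s'. (b, s) \<in> F \<longrightarrow> (b', s') \<in> F \<longrightarrow> (b, s) \<noteq> (b', s') \<longrightarrow>
        (\<exists>l<n. b l + s l \<le> b' l \<or> b' l + s' l \<le> b l)) \<and>
     (\<forall>x\<in>\<Lambda>. \<exists>b s. (b, s) \<in> F \<and> (\<forall>l<n. b l \<le> a l + r l * x l \<and> a l + r l * x l \<le> b l + s l))"

text \<open>Containment in the parent cuboid lets separation survive a refinement. Covering yields
  the upper bound on the covering number; meeting the image of \<open>\<Lambda>\<close>, separation
  and the bounds on the sides yield the lower one.\<close>

lemma approx_cubesD:
  assumes "approx_cubes \<eta> \<delta> n a r F"
  shows "finite F"
    and "\<And>b s l. (b, s) \<in> F \<Longrightarrow> l < n \<Longrightarrow> \<eta> \<le> s l \<and> s l \<le> \<delta> \<and> a l \<le> b l \<and> b l + s l \<le> a l + r l"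
    and "\<And>b s. (b, s) \<in> F \<Longrightarrow>
      \<exists>x\<in>\<Lambda>. \<forall>l<n. b l \<le> a l + r l * x l \<and> a l + r l * x l \<le> b l + s l"
    and "\<And>b s b' s'. (b, s) \<in> F \<Longrightarrow> (b', s') \<in> F \<Longrightarrow> (b, s) \<noteq> (b', s') \<Longrightarrow>
      \<exists>l<n. b l + s l \<le> b' l \<or> b' l + s' l \<le> b l"
    and "\<And>x. x \<in> \<Lambda> \<Longrightarrow>
      \<exists>b s. (b, s) \<in> F \<and> (\<forall>l<n. b l \<le> a l + r l * x l \<and> a l + r l * x l \<le> b l + s l)"
  using assms unfolding approx_cubes_def by meson+

lemma approx_cubesI:
  assumes "finite F"
    and "\<And>b s l. (b, s) \<in> F \<Longrightarrow> l < n \<Longrightarrow> \<eta> \<le> s l \<and> s l \<le> \<delta> \<and> a l \<le> b l \<and> b l + s l \<le> a l + r l"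
    and "\<And>b s. (b, s) \<in> F \<Longrightarrow>
      \<exists>x\<in>\<Lambda>. \<forall>l<n. b l \<le> a l + r l * x l \<and> a l + r l * x l \<le> b l + s l"
    and "\<And>b s b' s'. (b, s) \<in> F \<Longrightarrow> (b', s') \<in> F \<Longrightarrow> (b, s) \<noteq> (b', s') \<Longrightarrow>
      \<exists>l<n. b l + s l \<le> b' l \<or> b' l + s' l \<le> b l"
    and "\<And>x. x \<in> \<Lambda> \<Longrightarrow>
      \<exists>b s. (b, s) \<in> F \<and> (\<forall>l<n. b l \<le> a l + r l * x l \<and> a l + r l * x l \<le> b l + s l)"
  shows "approx_cubes \<eta> \<delta> n a r F"
  unfolding approx_cubes_def by (intro conjI allI impI ballI assms(1,3-)) (use assms(2) in blast)+

text \<open>Nothing is subdivided: every piece receives the whole interval from \<open>a n\<close>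
  to \<open>a n + r n\<close>, which contains the new coordinate because \<open>\<Lambda>\<close>
  lies in the unit cube.\<close>

lemma approx_cubes_add_coordinate:
  assumes F: "approx_cubes \<eta> \<delta> n a r F" and "0 < \<eta>" and "n < d" and r: "\<eta> \<le> r n" "r n \<le> \<delta>"
  shows "\<exists>F'. approx_cubes \<eta> \<delta> (Suc n) a r F' \<and> card F' = card F"
proof -
  define ext where "ext = (\<lambda>(b, s). (b(n := a n), s(n := r n)))"
  have ext [simp]: "ext (b, s) = (b(n := a n), s(n := r n))" for b s
    by (simp add: ext_def)
  note D = approx_cubesD[OF F]
  have last: "a n \<le> a n + r n * x n \<and> a n + r n * x n \<le> a n + r n" if "x \<in> \<Lambda>" for x
    using attractor_unit_interval[OF that \<open>n < d\<close>] r \<open>0 < \<eta>\<close> by (auto simp: mult_left_le)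
  \<comment> \<open>Distinct pieces are separated in some old coordinate; as sides are positive,
    their corners differ there, and \<open>ext\<close> keeps that coordinate.\<close>
  have "inj_on ext F"
  proof (rule inj_onI, rule ccontr)
    fix f g assume fg: "f \<in> F" "g \<in> F" "ext f = ext g" "f \<noteq> g"
    obtain b s b' s' where eq: "f = (b, s)" "g = (b', s')" by (metis surj_pair)
    have sep: "\<exists>l<n. b l + s l \<le> b' l \<or> b' l + s' l \<le> b l"
      using D(4) fg eq by auto
    then obtain l where l: "l < n" "b l + s l \<le> b' l \<or> b' l + s' l \<le> b l" by blast
    have "(b(n := a n)) l = (b'(n := a n)) l"
      using fg(3) eq by simp
    then show False
      using l D(2)[of b s l] D(2)[of b' s' l] fg eq \<open>0 < \<eta>\<close> by auto
  qed
  then have "card (ext ` F) = card F" by (rule card_image)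
  moreover have "approx_cubes \<eta> \<delta> (Suc n) a r (ext ` F)"
  proof (rule approx_cubesI)
    show "finite (ext ` F)" using D(1) by simp
  next
    fix b s l assume "(b, s) \<in> ext ` F" "l < Suc n"
    then obtain b' s' where "(b', s') \<in> F" "b = b'(n := a n)" "s = s'(n := r n)" by auto
    then show "\<eta> \<le> s l \<and> s l \<le> \<delta> \<and> a l \<le> b l \<and> b l + s l \<le> a l + r l"
      using D(2)[of b' s' l] r \<open>l < Suc n\<close> by (cases "l = n") auto
  next
    fix b s assume "(b, s) \<in> ext ` F"
    then obtain b' s' where "(b', s') \<in> F" "b = b'(n := a n)" "s = s'(n := r n)" by auto
    then show "\<exists>x\<in>\<Lambda>. \<forall>l<Suc n. b l \<le> a l + r l * x l \<and> a l + r l * x l \<le> b l + s l"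
      using D(3)[of b' s'] last by (fastforce simp: less_Suc_eq)
  next
    fix b1 s1 b2 s2 assume *: "(b1, s1) \<in> ext ` F" "(b2, s2) \<in> ext ` F" "(b1, s1) \<noteq> (b2, s2)"
    obtain b s where 1: "(b, s) \<in> F" "b1 = b(n := a n)" "s1 = s(n := r n)" using *(1) by auto
    obtain b' s' where 2: "(b', s') \<in> F" "b2 = b'(n := a n)" "s2 = s'(n := r n)" using *(2) by auto
    have "(b, s) \<noteq> (b', s')" using 1 2 *(3) by auto
    then obtain l where "l < n" "b l + s l \<le> b' l \<or> b' l + s' l \<le> b l"
      using D(4)[OF 1(1) 2(1)] by blast
    then show "\<exists>l<Suc n. b1 l + s1 l \<le> b2 l \<or> b2 l + s2 l \<le> b1 l"
      using 1 2 by (intro exI[of _ l]) auto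
  next
    fix x assume x: "x \<in> \<Lambda>"
    then obtain b s where bs: "(b, s) \<in> F"
      "\<forall>l<n. b l \<le> a l + r l * x l \<and> a l + r l * x l \<le> b l + s l"
      using D(5) by blast
    then have "ext (b, s) \<in> ext ` F" by blast
    moreover have "\<forall>l<Suc n. (b(n := a n)) l \<le> a l + r l * x l \<and>
        a l + r l * x l \<le> (b(n := a n)) l + (s(n := r n)) l"
      using bs(2) last[OF x] by (auto simp: less_Suc_eq)
    ultimately show "\<exists>b s. (b, s) \<in> ext ` F \<and>
        (\<forall>l<Suc n. b l \<le> a l + r l * x l \<and> a l + r l * x l \<le> b l + s l)"
      by (metis ext)
  qed
  ultimately show ?thesis by blast
qed

text \<open>The first \<open>n\<close> coordinates of a map depend only on the prefix of length
  \<open>n\<close>. Hence one step of the \<open>n\<close>-dimensional system splits the image of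
  \<open>\<Lambda>\<close> into parts indexed by \<open>w\<close>, and
  \<open>separated_intervals\<close> separates pieces of different parts.\<close>

lemma approx_cubes_refine:
  assumes n: "n \<in> {1..d}" and "0 < \<eta>" and r: "\<And>l. l < n \<Longrightarrow> 0 \<le> r l"
    and F: "\<And>w. w \<in> index_set br n \<Longrightarrow> approx_cubes \<eta> \<delta> n
      (\<lambda>l. a l + r l * t (take (Suc l) w)) (\<lambda>l. r l * lam (take (Suc l) w)) (F w)"
  shows "approx_cubes \<eta> \<delta> n a r (\<Union>w\<in>index_set br n. F w)"
    and "card (\<Union>w\<in>index_set br n. F w) = (\<Sum>w\<in>index_set br n. card (F w))"
proof -
  note D = approx_cubesD[OF F]
  have nd: "n \<le> d" using n by simp
  have sep: "\<exists>l<n. b l + s l \<le> b' l \<or> b' l + s' l \<le> b l"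
    if "v \<in> index_set br n" "w \<in> index_set br n" "v \<noteq> w" "(b, s) \<in> F v" "(b', s') \<in> F w"
    for v w b s b' s'
  proof -
    have le: "b l + s l \<le> b' l"
      if "l < n" "t (take (Suc l) v) + lam (take (Suc l) v) \<le> t (take (Suc l) w)"
        "v \<in> index_set br n" "w \<in> index_set br n" "(b, s) \<in> F v" "(b', s') \<in> F w"
      for l v w b s b' s'
      using D(2)[OF that(3,5,1)] D(2)[OF that(4,6,1)] mult_left_mono[OF that(2) r[OF that(1)]]
      by (simp add: algebra_simps)
    show ?thesis
      using separated_intervals[OF n that(1-3)] le that by meson
  qed
  \<comment> \<open>A piece shared by two words would be separated from itself, which its positive
    sides forbid. Hence the cardinalities add up.\<close>
  have eqF: "v = w" if vw: "v \<in> index_set br n" "w \<in> index_set br n" "f \<in> F v" "f \<in> F w" for v w f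
  proof (rule ccontr)
    assume "v \<noteq> w"
    obtain b s where f: "f = (b, s)" by (metis surj_pair)
    then obtain l where "l < n" "b l + s l \<le> b l"
      using sep[OF vw(1,2) \<open>v \<noteq> w\<close>, of b s b s] vw by auto
    then show False using D(2)[OF vw(1), of b s l] vw f \<open>0 < \<eta>\<close> by auto
  qed
  show "card (\<Union>w\<in>index_set br n. F w) = (\<Sum>w\<in>index_set br n. card (F w))"
    using D(1) eqF by (intro card_UN_disjoint) auto
  show "approx_cubes \<eta> \<delta> n a r (\<Union>w\<in>index_set br n. F w)"
  proof (rule approx_cubesI)
    show "finite (\<Union>w\<in>index_set br n. F w)" using D(1) by simp
  next
    fix b s l assume "(b, s) \<in> (\<Union>w\<in>index_set br n. F w)" and l: "l < n"
    then obtain w where w: "w \<in> index_set br n" "(b, s) \<in> F w" by blast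
    have "0 \<le> r l * t (take (Suc l) w)"
      using r[OF l] t_nonneg[OF nd w(1) l] by simp
    moreover have "r l * (t (take (Suc l) w) + lam (take (Suc l) w)) \<le> r l * 1"
      using r[OF l] t_add_lam_le[OF nd w(1) l] by (intro mult_left_mono)
    ultimately show "\<eta> \<le> s l \<and> s l \<le> \<delta> \<and> a l \<le> b l \<and> b l + s l \<le> a l + r l"
      using D(2)[OF w l] by (auto simp: algebra_simps)
  next
    fix b s assume "(b, s) \<in> (\<Union>w\<in>index_set br n. F w)"
    then obtain w where w: "w \<in> index_set br n" "(b, s) \<in> F w" by blast
    then obtain y where y: "y \<in> \<Lambda>" "\<And>l. l < n \<Longrightarrow>
      b l \<le> a l + r l * t (take (Suc l) w) + r l * lam (take (Suc l) w) * y l \<and>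
      a l + r l * t (take (Suc l) w) + r l * lam (take (Suc l) w) * y l \<le> b l + s l"
      using D(3)[OF w] by blast
    \<comment> \<open>A point of \<open>\<Lambda>\<close> is needed, so the prefix \<open>w\<close>
      is extended to a word of the full system.\<close>
    obtain v where v: "v \<in> index_set br d" "take n v = w"
      using index_set_extend[OF nd order_refl w(1)] by blast
    have "b l \<le> a l + r l * ifs_map lam t v y l \<and> a l + r l * ifs_map lam t v y l \<le> b l + s l"
      if "l < n" for l
    proof -
      have "take (Suc l) w = take (Suc l) v" using v that by (auto simp: min_def)
      then show ?thesis
        using y(2)[OF that] ifs_map_apply[OF v(1), of l y] that nd by (simp add: algebra_simps)
    qed
    then show "\<exists>x\<in>\<Lambda>. \<forall>l<n. b l \<le> a l + r l * x l \<and> a l + r l * x l \<le> b l + s l"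
      using ifs_map_attractor[OF v(1) y(1)] by blast
  next
    fix b s b' s' assume "(b, s) \<in> (\<Union>w\<in>index_set br n. F w)" "(b', s') \<in> (\<Union>w\<in>index_set br n. F w)"
      and neq: "(b, s) \<noteq> (b', s')"
    then obtain v w where vw: "v \<in> index_set br n" "(b, s) \<in> F v" "w \<in> index_set br n" "(b', s') \<in> F w"
      by blast
    show "\<exists>l<n. b l + s l \<le> b' l \<or> b' l + s' l \<le> b l"
    proof (cases "v = w")
      case True
      then show ?thesis using D(4)[OF vw(1,2)] vw neq by blast
    next
      case False
      then show ?thesis using sep vw by blast
    qed
  next
    fix x assume "x \<in> \<Lambda>"
    then obtain v y where v: "v \<in> index_set br d" "y \<in> \<Lambda>" "x = ifs_map lam t v y"
      by (rule attractor_cases)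
    let ?w = "take n v"
    have w: "?w \<in> index_set br n" using take_index_set[OF v(1) nd] .
    obtain b s where bs: "(b, s) \<in> F ?w" "\<And>l. l < n \<Longrightarrow>
      b l \<le> a l + r l * t (take (Suc l) ?w) + r l * lam (take (Suc l) ?w) * y l \<and>
      a l + r l * t (take (Suc l) ?w) + r l * lam (take (Suc l) ?w) * y l \<le> b l + s l"
      using D(5)[OF w v(2)] by blast
    have "b l \<le> a l + r l * x l \<and> a l + r l * x l \<le> b l + s l" if "l < n" for l
    proof -
      have "take (Suc l) ?w = take (Suc l) v" using that by (auto simp: min_def)
      then show ?thesis
        using bs(2)[OF that] ifs_map_apply[OF v(1), of l y] v(3) that nd by (simp add: algebra_simps)
    qed
    then show "\<exists>b s. (b, s) \<in> (\<Union>w\<in>index_set br n. F w) \<and>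
        (\<forall>l<n. b l \<le> a l + r l * x l \<and> a l + r l * x l \<le> b l + s l)"
      using bs(1) w by blast
  qed
qed

section \<open>Counting approximate cubes\<close>

text \<open>The weights factor out and add up to \<open>1\<close>: a subdivision preserves the
  product that bounds the number of pieces. It is used with \<open>\<epsilon>\<close> equal to
  \<open>\<delta>\<close> and to \<open>\<mu> * \<delta>\<close>.\<close>

lemma sum_scaled_weights:
  assumes "n \<le> d" and "\<And>l. l < n \<Longrightarrow> 0 < r l" and "0 < \<epsilon>"
  shows "(\<Sum>w\<in>index_set br n. \<Prod>l<n. (r l * lam (take (Suc l) w) / \<epsilon>) powr \<sigma> l) =
    (\<Prod>l<n. (r l / \<epsilon>) powr \<sigma> l)"
proof -
  have "(\<Prod>l<n. (r l * lam (take (Suc l) w) / \<epsilon>) powr \<sigma> l) =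
    (\<Prod>l<n. (r l / \<epsilon>) powr \<sigma> l) * weight lam \<sigma> n w" if w: "w \<in> index_set br n" for w
    unfolding weight_def prod.distrib[symmetric]
  proof (intro prod.cong refl)
    fix l assume "l \<in> {..<n}"
    then have "0 < r l" "0 < lam (take (Suc l) w)"
      using assms lam_pos[OF assms(1) w] by auto
    then show "(r l * lam (take (Suc l) w) / \<epsilon>) powr \<sigma> l = (r l / \<epsilon>) powr \<sigma> l * lam (take (Suc l) w) powr \<sigma> l"
      using \<open>0 < \<epsilon>\<close> powr_mult[of "r l / \<epsilon>" "lam (take (Suc l) w)" "\<sigma> l"] by simp
  qed
  then show ?thesis
    using sum_weight[OF assms(1)] by (simp add: sum_distrib_left[symmetric])
qed

text \<open>
  A cuboid whose shortest active side exceeds \<open>\<delta>\<close> is subdivided; otherwise that side is left as it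
  is and its coordinate is no longer active.
\<close>

lemma approx_cubes_exist:
  assumes \<mu>: "0 < \<mu>" "\<And>n w l. n \<le> d \<Longrightarrow> w \<in> index_set br n \<Longrightarrow> l < n \<Longrightarrow> \<mu> \<le> lam (take (Suc l) w)"
    and \<nu>: "\<nu> < 1" "\<And>n w l. n \<le> d \<Longrightarrow> w \<in> index_set br n \<Longrightarrow> l < n \<Longrightarrow> lam (take (Suc l) w) \<le> \<nu>"
    and "0 < \<delta>"
    and "n \<le> d" and "\<And>l. l < n \<Longrightarrow> \<mu> * \<delta> \<le> r l"
    and "\<And>l k. l \<le> k \<Longrightarrow> k < n \<Longrightarrow> r k \<le> r l"
  shows "\<exists>F. approx_cubes (\<mu> * \<delta>) \<delta> n a r F \<and>
    (\<Prod>l<n. (r l / \<delta>) powr \<sigma> l) \<le> card F \<and> card F \<le> (\<Prod>l<n. (r l / (\<mu> * \<delta>)) powr \<sigma> l)"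
  using assms(6-)
proof (induction n arbitrary: a r)
  case 0
  have "approx_cubes (\<mu> * \<delta>) \<delta> 0 a r {(a, r)}"
    using attractor(1) by (auto simp: approx_cubes_def)
  then show ?case by (intro exI[of _ "{(a, r)}"]) simp
next
  case (Suc n)
  have \<eta>: "0 < \<mu> * \<delta>" using \<mu> \<open>0 < \<delta>\<close> by simp
  \<comment> \<open>If the last side is at most \<open>\<delta>\<close>, its coordinate is dropped,
    the outer induction hypothesis applies, and the side is restored. As \<open>\<sigma> n\<close>
    is nonnegative, the extra factor is at most \<open>1\<close> in the lower bound and at least
    \<open>1\<close> in the upper one.\<close>
  have small: "\<exists>F. approx_cubes (\<mu> * \<delta>) \<delta> (Suc n) a r F \<and>
    (\<Prod>l<Suc n. (r l / \<delta>) powr \<sigma> l) \<le> card F \<and> card F \<le> (\<Prod>l<Suc n. (r l / (\<mu> * \<delta>)) powr \<sigma> l)"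
    if r: "\<And>l. l < Suc n \<Longrightarrow> \<mu> * \<delta> \<le> r l" "\<And>l k. l \<le> k \<Longrightarrow> k < Suc n \<Longrightarrow> r k \<le> r l" "r n \<le> \<delta>" for a r
  proof -
    obtain F where F: "approx_cubes (\<mu> * \<delta>) \<delta> n a r F" "(\<Prod>l<n. (r l / \<delta>) powr \<sigma> l) \<le> card F"
      "card F \<le> (\<Prod>l<n. (r l / (\<mu> * \<delta>)) powr \<sigma> l)"
      using Suc.IH[of r a] Suc.prems r by auto
    obtain F' where F': "approx_cubes (\<mu> * \<delta>) \<delta> (Suc n) a r F'" "card F' = card F"
      using approx_cubes_add_coordinate[OF F(1) \<eta>] Suc.prems r(1)[of n] r(3) by auto
    have rn: "0 \<le> r n" using r(1)[of n] \<eta> by simp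
    have "(r n / \<delta>) powr \<sigma> n \<le> 1"
      using rn r(3) \<open>0 < \<delta>\<close> \<sigma>_nonneg powr_le1 by simp
    then have "(\<Prod>l<Suc n. (r l / \<delta>) powr \<sigma> l) \<le> (\<Prod>l<n. (r l / \<delta>) powr \<sigma> l)"
      by (simp add: mult_left_le prod_nonneg)
    moreover have "1 \<le> (r n / (\<mu> * \<delta>)) powr \<sigma> n"
      using r(1)[of n] \<eta> \<sigma>_nonneg ge_one_powr_ge_zero by simp
    then have "(\<Prod>l<n. (r l / (\<mu> * \<delta>)) powr \<sigma> l) \<le> (\<Prod>l<Suc n. (r l / (\<mu> * \<delta>)) powr \<sigma> l)"
      using mult_left_mono[of 1 "(r n / (\<mu> * \<delta>)) powr \<sigma> n" "\<Prod>l<n. (r l / (\<mu> * \<delta>)) powr \<sigma> l"]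
      by (simp add: prod_nonneg)
    ultimately show ?thesis using F F' by (intro exI[of _ F']) auto
  qed
  \<comment> \<open>Here \<open>j\<close> bounds the number of subdivisions needed before the last
    side is at most \<open>\<delta>\<close>: each one shrinks it by a factor of at most
    \<open>\<nu>\<close>.\<close>
  have main: "\<exists>F. approx_cubes (\<mu> * \<delta>) \<delta> (Suc n) a r F \<and>
    (\<Prod>l<Suc n. (r l / \<delta>) powr \<sigma> l) \<le> card F \<and> card F \<le> (\<Prod>l<Suc n. (r l / (\<mu> * \<delta>)) powr \<sigma> l)"
    if "\<And>l. l < Suc n \<Longrightarrow> \<mu> * \<delta> \<le> r l" "\<And>l k. l \<le> k \<Longrightarrow> k < Suc n \<Longrightarrow> r k \<le> r l" "r n * \<nu> ^ j \<le> \<delta>"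
    for a r j
    using that
  proof (induction j arbitrary: a r)
    case 0
    then show ?case using small by simp
  next
    case (Suc j)
    show ?case
    proof (cases "r n \<le> \<delta>")
      case True
      then show ?thesis using small Suc.prems by blast
    next
      case False
      let ?I = "index_set br (Suc n)"
      let ?r = "\<lambda>w l. r l * lam (take (Suc l) w)"
      \<comment> \<open>The last side is the shortest, so all sides exceed \<open>\<delta>\<close>
        and remain at least \<open>\<mu> * \<delta>\<close> after one contraction.\<close>
      have r: "\<delta> < r l" if "l < Suc n" for l
        using Suc.prems(2)[of l n] that False by simp
      have rpos: "0 < r l" if "l < Suc n" for l
        using r[OF that] \<open>0 < \<delta>\<close> by simp
      have "\<exists>F. approx_cubes (\<mu> * \<delta>) \<delta> (Suc n) (\<lambda>l. a l + r l * t (take (Suc l) w)) (?r w) F \<and>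
        (\<Prod>l<Suc n. (?r w l / \<delta>) powr \<sigma> l) \<le> card F \<and> card F \<le> (\<Prod>l<Suc n. (?r w l / (\<mu> * \<delta>)) powr \<sigma> l)"
        if w: "w \<in> ?I" for w
      proof (rule Suc.IH)
        fix l assume l: "l < Suc n"
        have "\<mu> * \<delta> \<le> lam (take (Suc l) w) * r l"
          using \<mu> r[OF l] \<open>0 < \<delta>\<close> \<mu>(2)[OF \<open>Suc n \<le> d\<close> w l] by (intro mult_mono) auto
        then show "\<mu> * \<delta> \<le> ?r w l" by (simp add: mult.commute)
      next
        fix l k assume lk: "l \<le> k" "k < Suc n"
        show "?r w k \<le> ?r w l"
          using Suc.prems(2)[OF lk] lam_antimono[OF \<open>Suc n \<le> d\<close> w lk] rpos lk
            lam_pos[OF \<open>Suc n \<le> d\<close> w]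
          by (intro mult_mono) (auto simp: less_imp_le)
      next
        have "0 < lam (take (Suc n) w)" "lam (take (Suc n) w) \<le> \<nu>"
          using lam_pos[OF \<open>Suc n \<le> d\<close> w] \<nu>(2)[OF \<open>Suc n \<le> d\<close> w] by simp_all
        then have "?r w n * \<nu> ^ j \<le> r n * \<nu> * \<nu> ^ j"
          using rpos[of n] by (intro mult_right_mono mult_left_mono) auto
        then show "?r w n * \<nu> ^ j \<le> \<delta>"
          using Suc.prems(3) by (simp add: mult.assoc)
      qed
      then have "\<forall>w\<in>?I. \<exists>F. approx_cubes (\<mu> * \<delta>) \<delta> (Suc n) (\<lambda>l. a l + r l * t (take (Suc l) w)) (?r w) F \<and>
        (\<Prod>l<Suc n. (?r w l / \<delta>) powr \<sigma> l) \<le> card F \<and> card F \<le> (\<Prod>l<Suc n. (?r w l / (\<mu> * \<delta>)) powr \<sigma> l)"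
        by (rule ballI)
      from bchoice[OF this] obtain F where F:
        "\<And>w. w \<in> ?I \<Longrightarrow> approx_cubes (\<mu> * \<delta>) \<delta> (Suc n) (\<lambda>l. a l + r l * t (take (Suc l) w)) (?r w) (F w)"
        "\<And>w. w \<in> ?I \<Longrightarrow> (\<Prod>l<Suc n. (?r w l / \<delta>) powr \<sigma> l) \<le> card (F w)"
        "\<And>w. w \<in> ?I \<Longrightarrow> card (F w) \<le> (\<Prod>l<Suc n. (?r w l / (\<mu> * \<delta>)) powr \<sigma> l)"
        by blast
      have *: "approx_cubes (\<mu> * \<delta>) \<delta> (Suc n) a r (\<Union>w\<in>?I. F w)"
        "card (\<Union>w\<in>?I. F w) = (\<Sum>w\<in>?I. card (F w))"
        using approx_cubes_refine[of "Suc n" "\<mu> * \<delta>" r \<delta> a F] \<open>Suc n \<le> d\<close> \<eta> rpos F(1)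
        by (auto simp: less_imp_le simp del: index_set.simps(2))
      have sum: "(\<Sum>w\<in>?I. \<Prod>l<Suc n. (?r w l / \<epsilon>) powr \<sigma> l) = (\<Prod>l<Suc n. (r l / \<epsilon>) powr \<sigma> l)"
        if "0 < \<epsilon>" for \<epsilon>
        using \<open>Suc n \<le> d\<close> rpos that by (rule sum_scaled_weights)
      have "(\<Prod>l<Suc n. (r l / \<delta>) powr \<sigma> l) \<le> (\<Sum>w\<in>?I. real (card (F w)))"
        unfolding sum[OF \<open>0 < \<delta>\<close>, symmetric] by (rule sum_mono) (rule F(2))
      moreover have "(\<Sum>w\<in>?I. real (card (F w))) \<le> (\<Prod>l<Suc n. (r l / (\<mu> * \<delta>)) powr \<sigma> l)"
        unfolding sum[OF \<eta>, symmetric] by (rule sum_mono) (rule F(3))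
      ultimately show ?thesis using * by (intro exI[of _ "\<Union>w\<in>?I. F w"]) auto
    qed
  qed
  have "0 \<le> \<nu>"
  proof -
    obtain w where w: "w \<in> index_set br 1"
      using index_set_extend[of 0 1 "[]"] d_pos by auto
    show ?thesis using lam_pos[OF _ w, of 0] \<nu>(2)[OF _ w, of 0] d_pos by simp
  qed
  then have "(\<lambda>j. r n * \<nu> ^ j) \<longlonglongrightarrow> r n * 0"
    using \<nu>(1) by (intro tendsto_mult tendsto_const LIMSEQ_realpow_zero)
  then have "eventually (\<lambda>j. r n * \<nu> ^ j < \<delta>) sequentially"
    using \<open>0 < \<delta>\<close> by (intro order_tendstoD(2)) simp_all
  then obtain j where "r n * \<nu> ^ j < \<delta>"
    by (auto simp: eventually_sequentially)
  then show ?case using main[of r j a] Suc.prems by (simp add: less_imp_le)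
qed

lemma lam_bounds:
  obtains \<mu> \<nu> :: real where "0 < \<mu>" "\<mu> < 1"
    "\<And>n w l. n \<le> d \<Longrightarrow> w \<in> index_set br n \<Longrightarrow> l < n \<Longrightarrow> \<mu> \<le> lam (take (Suc l) w)"
    "\<nu> < 1" "\<And>n w l. n \<le> d \<Longrightarrow> w \<in> index_set br n \<Longrightarrow> l < n \<Longrightarrow> lam (take (Suc l) w) \<le> \<nu>"
proof -
  define L where "L = (\<Union>n\<in>{1..d}. lam ` index_set br n)"
  have fin: "finite L" by (simp add: L_def)
  obtain w where w: "w \<in> index_set br 1"
    using index_set_extend[of 0 1 "[]"] d_pos by auto
  then have ne: "L \<noteq> {}"
    using d_pos by (auto simp: L_def simp del: index_set.simps intro!: bexI[of _ 1])
  have L: "0 < x \<and> x < 1" if "x \<in> L" for x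
    using that sponge by (auto simp: L_def sponge_ifs_def)
  have mem: "lam (take (Suc l) w) \<in> L" if "n \<le> d" "w \<in> index_set br n" "l < n" for n w l
    using take_index_set[OF that(2), of "Suc l"] that unfolding L_def
    by (intro UN_I[of "Suc l"]) (auto simp del: index_set.simps(2))
  show thesis
    by (rule that[of "Min L" "Max L"]) (use fin ne L mem in auto)
qed

section \<open>Comparison with covering numbers\<close>

text \<open>Dividing the corners by \<open>\<eta>\<close> and rounding up is injective, since
  separated pieces have corners at least \<open>\<eta>\<close> apart in some coordinate. A piece
  meeting the box has its corner within \<open>\<delta>\<close> of \<open>c\<close> in each
  coordinate, which leaves boundedly many integers.\<close>

lemma card_approx_cubes_meeting_box:
  assumes F: "approx_cubes \<eta> \<delta> d a r F" and "0 < \<eta>" and "\<eta> \<le> \<delta>"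
  shows "card {f \<in> F. \<exists>x. \<forall>l<d. fst f l \<le> x l \<and> x l \<le> fst f l + snd f l \<and> c l \<le> x l \<and> x l \<le> c l + \<delta>}
    \<le> (nat \<lceil>2 * \<delta> / \<eta> + 2\<rceil>) ^ d"
proof -
  let ?G = "{f \<in> F. \<exists>x. \<forall>l<d. fst f l \<le> x l \<and> x l \<le> fst f l + snd f l \<and> c l \<le> x l \<and> x l \<le> c l + \<delta>}"
  \<comment> \<open>The restriction to \<open>{..<d}\<close> discards irrelevant coordinates and
    places the values of \<open>h\<close> in a finite product \<open>PiE\<close>.\<close>
  define h where "h f = (\<lambda>l\<in>{..<d}. \<lceil>fst f l / \<eta>\<rceil>)" for f :: "(nat \<Rightarrow> real) \<times> (nat \<Rightarrow> real)"
  define J where "J l = {\<lceil>(c l - \<delta>) / \<eta>\<rceil>..\<lceil>(c l + \<delta>) / \<eta>\<rceil>}" for l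
  note D = approx_cubesD[OF F]
  have inj: "inj_on h ?G"
  proof (rule inj_onI, rule ccontr)
    fix f g assume fg: "f \<in> ?G" "g \<in> ?G" "h f = h g" "f \<noteq> g"
    obtain b s b' s' where eq: "f = (b, s)" "g = (b', s')" by (metis surj_pair)
    obtain l where l: "l < d" "b l + s l \<le> b' l \<or> b' l + s' l \<le> b l"
      using D(4)[of b s b' s'] fg eq by auto
    have "\<eta> \<le> s l" "\<eta> \<le> s' l" using D(2) l fg eq by auto
    then have "b l + \<eta> \<le> b' l \<or> b' l + \<eta> \<le> b l" using l by auto
    then have "(b l + \<eta>) / \<eta> \<le> b' l / \<eta> \<or> (b' l + \<eta>) / \<eta> \<le> b l / \<eta>"
      using \<open>0 < \<eta>\<close> by (simp add: divide_le_cancel)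
    then have "b l / \<eta> + 1 \<le> b' l / \<eta> \<or> b' l / \<eta> + 1 \<le> b l / \<eta>"
      using \<open>0 < \<eta>\<close> by (simp add: add_divide_distrib)
    then have "\<lceil>b l / \<eta>\<rceil> \<noteq> \<lceil>b' l / \<eta>\<rceil>" by linarith
    moreover have "h f l = h g l" using fg by simp
    ultimately show False using l eq by (simp add: h_def)
  qed
  have sub: "h ` ?G \<subseteq> PiE {..<d} J"
  proof
    fix z assume "z \<in> h ` ?G"
    then obtain f where f: "f \<in> ?G" "z = h f" by (rule imageE)
    obtain b s where bs: "f = (b, s)" by (rule prod.exhaust)
    have "(b, s) \<in> F" using f(1) bs by simp
    from f(1) obtain x where "\<forall>l<d. fst f l \<le> x l \<and> x l \<le> fst f l + snd f l \<and> c l \<le> x l \<and> x l \<le> c l + \<delta>"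
      by (elim CollectE conjE exE)
    then have *: "(b, s) \<in> F" "z = h (b, s)"
      "\<And>l. l < d \<Longrightarrow> b l \<le> x l \<and> x l \<le> b l + s l \<and> c l \<le> x l \<and> x l \<le> c l + \<delta>"
      using \<open>(b, s) \<in> F\<close> f(2) bs by simp_all
    have "c l - \<delta> \<le> b l \<and> b l \<le> c l + \<delta>" if "l < d" for l
      using *(3)[OF that] D(2)[OF *(1) that] by linarith
    then have "\<lceil>b l / \<eta>\<rceil> \<in> J l" if "l < d" for l
      using that \<open>0 < \<eta>\<close> by (auto simp: J_def intro!: ceiling_mono divide_right_mono)
    then show "z \<in> PiE {..<d} J"
      using *(2) by (auto simp: h_def)
  qed
  have "finite (PiE {..<d} J)" by (intro finite_PiE) (auto simp: J_def)
  then have "card ?G \<le> card (PiE {..<d} J)"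
    using inj sub by (rule card_inj_on_le[rotated 2])
  also have "\<dots> = (\<Prod>l<d. card (J l))" by (simp add: card_PiE)
  also have "\<dots> \<le> (\<Prod>l<d. nat \<lceil>2 * \<delta> / \<eta> + 2\<rceil>)"
  proof (rule prod_mono, safe)
    fix l
    have "(c l + \<delta>) / \<eta> - (c l - \<delta>) / \<eta> = 2 * \<delta> / \<eta>"
      using \<open>0 < \<eta>\<close> by (simp add: field_simps)
    \<comment> \<open>The left side counts the integers in \<open>J l\<close>; rounding contributes
      less than \<open>1\<close> and the closed range one more, whence the summand
      \<open>2\<close>.\<close>
    then have "\<lceil>(c l + \<delta>) / \<eta>\<rceil> + 1 - \<lceil>(c l - \<delta>) / \<eta>\<rceil> \<le> \<lceil>2 * \<delta> / \<eta> + 2\<rceil>" by linarith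
    then show "card (J l) \<le> nat \<lceil>2 * \<delta> / \<eta> + 2\<rceil>" by (simp add: J_def)
  qed
  also have "\<dots> = (nat \<lceil>2 * \<delta> / \<eta> + 2\<rceil>) ^ d" by simp
  finally show ?thesis .
qed

text \<open>Upper bound: enlarge each piece to the box of side \<open>\<delta>\<close> at its lower
  corner. Lower bound: each piece contains a point of \<open>\<Lambda>\<close> up to irrelevant
  coordinates, hence meets a box of an optimal cover, and each box meets boundedly many
  pieces.\<close>

lemma covering_number_bounds:
  assumes F: "approx_cubes \<eta> \<delta> d (\<lambda>_. 0) (\<lambda>_. 1) F" and "0 < \<eta>" and "\<eta> \<le> \<delta>"
  shows "covering_number d \<delta> \<Lambda> \<le> card F"
    and "card F \<le> covering_number d \<delta> \<Lambda> * (nat \<lceil>2 * \<delta> / \<eta> + 2\<rceil>) ^ d"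
proof -
  note D = approx_cubesD[OF F]
  let ?cov = "\<lambda>m. \<exists>\<B>. finite \<B> \<and> card \<B> = m \<and> (\<forall>B\<in>\<B>. is_box d \<delta> B) \<and> \<Lambda> \<subseteq> \<Union>\<B>"
  define box where "box = (\<lambda>b. {x \<in> topspace (Euclidean_space d). \<forall>k<d. b k \<le> x k \<and> x k \<le> b k + \<delta>})"
  have is_box_iff: "is_box d \<delta> B \<longleftrightarrow> (\<exists>c. B = box c)" for B
    unfolding is_box_def box_def ..
  have "\<Lambda> \<subseteq> \<Union>((\<lambda>f. box (fst f)) ` F)"
  proof
    fix x assume x: "x \<in> \<Lambda>"
    then obtain b s where bs: "(b, s) \<in> F" "\<And>l. l < d \<Longrightarrow> b l \<le> x l \<and> x l \<le> b l + s l"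
      using D(5)[OF x] by auto
    have "b l \<le> x l \<and> x l \<le> b l + \<delta>" if "l < d" for l
      using bs(2)[OF that] D(2)[OF bs(1) that] by linarith
    then have "x \<in> box b" using x attractor_topspace by (auto simp: box_def)
    then show "x \<in> \<Union>((\<lambda>f. box (fst f)) ` F)" using bs(1) by force
  qed
  moreover have "\<forall>B\<in>(\<lambda>f. box (fst f)) ` F. is_box d \<delta> B"
    unfolding is_box_iff by (intro ballI, elim imageE) (rule exI)
  ultimately have cov: "?cov (card ((\<lambda>f. box (fst f)) ` F))"
    using D(1) by (intro exI[of _ "(\<lambda>f. box (fst f)) ` F"] conjI finite_imageI refl)
  have "covering_number d \<delta> \<Lambda> \<le> card ((\<lambda>f. box (fst f)) ` F)"
    unfolding covering_number_def by (rule Least_le) (rule cov)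
  also have "\<dots> \<le> card F" using D(1) by (rule card_image_le)
  finally show "covering_number d \<delta> \<Lambda> \<le> card F" .
  \<comment> \<open>The cover just built shows that the set of cardinalities is nonempty, so its
    least element is attained.\<close>
  have "?cov (covering_number d \<delta> \<Lambda>)"
    unfolding covering_number_def by (rule LeastI[where P = ?cov, OF cov])
  then obtain \<B> where \<B>: "finite \<B>" "card \<B> = covering_number d \<delta> \<Lambda>" "\<And>B. B \<in> \<B> \<Longrightarrow> is_box d \<delta> B"
    "\<Lambda> \<subseteq> \<Union>\<B>" by (elim exE conjE) (rule that, simp_all)
  have "\<forall>B\<in>\<B>. \<exists>c. B = box c"
    by (intro ballI) (rule iffD1[OF is_box_iff \<B>(3)])
  from bchoice[OF this] obtain c where c: "\<forall>B\<in>\<B>. B = box (c B)" ..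
  let ?M = "\<lambda>c. {f \<in> F. \<exists>x. \<forall>l<d. fst f l \<le> x l \<and> x l \<le> fst f l + snd f l \<and> c l \<le> x l \<and> x l \<le> c l + \<delta>}"
  have "F \<subseteq> (\<Union>B\<in>\<B>. ?M (c B))"
  proof
    fix f assume f: "f \<in> F"
    obtain b s where bs: "f = (b, s)" by (metis surj_pair)
    obtain x where x: "x \<in> \<Lambda>" "\<And>l. l < d \<Longrightarrow> b l \<le> x l \<and> x l \<le> b l + s l"
      using D(3)[of b s] f bs by auto
    obtain B where B: "B \<in> \<B>" "x \<in> B" using x \<B>(4) by blast
    have "x \<in> box (c B)" using B bspec[OF c] by blast
    then have "f \<in> ?M (c B)" using f bs x(2) by (auto simp: box_def)
    then show "f \<in> (\<Union>B\<in>\<B>. ?M (c B))" using B(1) by blast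
  qed
  then have "card F \<le> card (\<Union>B\<in>\<B>. ?M (c B))"
    using D(1) \<B>(1) by (intro card_mono) auto
  also have "\<dots> \<le> (\<Sum>B\<in>\<B>. card (?M (c B)))"
    using \<B>(1) by (rule card_UN_le)
  also have "\<dots> \<le> (\<Sum>B\<in>\<B>. (nat \<lceil>2 * \<delta> / \<eta> + 2\<rceil>) ^ d)"
    by (rule sum_mono) (rule card_approx_cubes_meeting_box[OF F assms(2,3)])
  finally show "card F \<le> covering_number d \<delta> \<Lambda> * (nat \<lceil>2 * \<delta> / \<eta> + 2\<rceil>) ^ d"
    using \<B>(2) by simp
qed

text \<open>With \<open>s\<close> the sum of the exponents, the covering number lies between
  \<open>\<delta>\<close> to the power \<open>- s\<close> divided by \<open>C\<close> and
  \<open>\<mu> * \<delta>\<close> to the power \<open>- s\<close>. After division by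
  \<open>- ln \<delta>\<close> the constants disappear in the limit.\<close>

lemma has_box_dimension_sum_\<sigma>: "has_box_dimension d \<Lambda> (\<Sum>l<d. \<sigma> l)"
proof -
  let ?s = "\<Sum>l<d. \<sigma> l"
  let ?N = "\<lambda>\<delta>. covering_number d \<delta> \<Lambda>"
  obtain \<mu> \<nu> where \<mu>: "0 < \<mu>" "\<mu> < 1"
    "\<And>n w l. n \<le> d \<Longrightarrow> w \<in> index_set br n \<Longrightarrow> l < n \<Longrightarrow> \<mu> \<le> lam (take (Suc l) w)"
    and \<nu>: "\<nu> < 1" "\<And>n w l. n \<le> d \<Longrightarrow> w \<in> index_set br n \<Longrightarrow> l < n \<Longrightarrow> lam (take (Suc l) w) \<le> \<nu>"
    by (rule lam_bounds) blast
  \<comment> \<open>This is the bound on pieces per box for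
    \<open>\<eta> = \<mu> * \<delta>\<close>; the scale cancels, so \<open>C\<close> does not depend
    on \<open>\<delta>\<close>.\<close>
  define C where "C = (nat \<lceil>2 / \<mu> + 2\<rceil>) ^ d"
  have C: "0 < C" using \<mu>(1) by (auto simp: C_def intro: add_pos_pos)
  have bounds: "?s - ln C / - ln \<delta> \<le> ln (?N \<delta>) / - ln \<delta>" "ln (?N \<delta>) / - ln \<delta> \<le> ?s - ?s * ln \<mu> / - ln \<delta>"
    if \<delta>: "0 < \<delta>" "\<delta> < 1" for \<delta>
  proof -
    have "\<mu> * \<delta> \<le> 1" "\<mu> * \<delta> \<le> \<delta>" "0 < \<mu> * \<delta>"
      using \<mu> \<delta> mult_mono[of \<mu> 1 \<delta> 1] by auto
    have "\<exists>F. approx_cubes (\<mu> * \<delta>) \<delta> d (\<lambda>_. 0) (\<lambda>_. 1) F \<and>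
      (\<Prod>l<d. (1 / \<delta>) powr \<sigma> l) \<le> card F \<and> card F \<le> (\<Prod>l<d. (1 / (\<mu> * \<delta>)) powr \<sigma> l)"
      by (rule approx_cubes_exist[where \<mu> = \<mu> and \<nu> = \<nu> and r = "\<lambda>_. 1" and a = "\<lambda>_. 0"])
        (assumption | rule \<mu>(1,3) \<nu> \<delta>(1) order_refl \<open>\<mu> * \<delta> \<le> 1\<close>)+
    then obtain F where F: "approx_cubes (\<mu> * \<delta>) \<delta> d (\<lambda>_. 0) (\<lambda>_. 1) F"
      "(\<Prod>l<d. (1 / \<delta>) powr \<sigma> l) \<le> card F" "card F \<le> (\<Prod>l<d. (1 / (\<mu> * \<delta>)) powr \<sigma> l)"
      by blast
    have prod: "(\<Prod>l<d. x powr \<sigma> l) = x powr ?s" if "0 < x" for x :: real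
      using that by (simp add: powr_sum)
    have "nat \<lceil>2 * \<delta> / (\<mu> * \<delta>) + 2\<rceil> ^ d = C"
      using \<delta>(1) by (simp add: C_def)
    then have N: "?N \<delta> \<le> card F" "card F \<le> ?N \<delta> * C"
      using covering_number_bounds[OF F(1) \<open>0 < \<mu> * \<delta>\<close> \<open>\<mu> * \<delta> \<le> \<delta>\<close>] by simp_all
    have lo: "(1 / \<delta>) powr ?s \<le> real (?N \<delta>) * real C"
    proof -
      have "(1 / \<delta>) powr ?s \<le> real (card F)"
        using F(2) \<delta>(1) by (simp only: prod zero_less_divide_1_iff)
      also have "\<dots> \<le> real (?N \<delta> * C)"
        using N(2) by (simp only: of_nat_le_iff)
      finally show ?thesis by simp
    qed
    have hi: "real (?N \<delta>) \<le> (1 / (\<mu> * \<delta>)) powr ?s"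
    proof -
      have "real (?N \<delta>) \<le> real (card F)"
        using N(1) by simp
      also have "\<dots> \<le> (1 / (\<mu> * \<delta>)) powr ?s"
        using F(3) \<open>0 < \<mu> * \<delta>\<close> by (simp only: prod zero_less_divide_1_iff)
      finally show ?thesis .
    qed
    have "0 < (1 / \<delta>) powr ?s" using \<delta>(1) by simp
    then have "0 < real (?N \<delta>) * real C" using lo by (rule order_less_le_trans)
    then have Npos: "0 < real (?N \<delta>)" by (simp add: zero_less_mult_iff)
    have "ln ((1 / \<delta>) powr ?s) \<le> ln (real (?N \<delta>) * real C)"
      using lo \<open>0 < (1 / \<delta>) powr ?s\<close> by (intro ln_mono) auto
    then have 1: "?s * - ln \<delta> - ln C \<le> ln (?N \<delta>)"
      using \<delta>(1) Npos C by (simp add: ln_powr ln_div ln_mult)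
    have "ln (real (?N \<delta>)) \<le> ln ((1 / (\<mu> * \<delta>)) powr ?s)"
      using hi Npos by (intro ln_mono) auto
    then have 2: "ln (?N \<delta>) \<le> ?s * - ln \<delta> - ?s * ln \<mu>"
      using \<delta>(1) \<mu>(1) by (simp add: ln_powr ln_div ln_mult algebra_simps)
    have "0 < - ln \<delta>" using \<delta> by simp
    then show "?s - ln C / - ln \<delta> \<le> ln (?N \<delta>) / - ln \<delta>"
      "ln (?N \<delta>) / - ln \<delta> \<le> ?s - ?s * ln \<mu> / - ln \<delta>"
      using divide_right_mono[OF 1, of "- ln \<delta>"] divide_right_mono[OF 2, of "- ln \<delta>"]
      by (simp_all add: diff_divide_distrib)
  qed
  have ev: "eventually (\<lambda>\<delta>::real. 0 < \<delta> \<and> \<delta> < 1) (at_right 0)"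
    using eventually_at_right_real[of 0 "1::real"] by simp
  have inf: "filterlim (\<lambda>\<delta>::real. - ln \<delta>) at_top (at_right 0)"
    using ln_at_0 by (simp add: filterlim_uminus_at_top)
  have lim: "((\<lambda>\<delta>. ?s - A / - ln \<delta>) \<longlongrightarrow> ?s) (at_right 0)" for A :: real
    using tendsto_diff[OF tendsto_const[of ?s] real_tendsto_divide_at_top[OF tendsto_const[of A] inf]] by simp
  show ?thesis
    unfolding has_box_dimension_def
  proof (rule tendsto_sandwich[OF _ _ lim lim])
    show "eventually (\<lambda>\<delta>. ?s - ln C / - ln \<delta> \<le> ln (?N \<delta>) / - ln \<delta>) (at_right 0)"
      using ev by eventually_elim (rule bounds, auto)
    show "eventually (\<lambda>\<delta>. ln (?N \<delta>) / - ln \<delta> \<le> ?s - ?s * ln \<mu> / - ln \<delta>) (at_right 0)"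
      using ev by eventually_elim (rule bounds, auto)
  qed
qed

end

theorem proposition4p1:
  fixes d :: nat
    and br :: "nat list \<Rightarrow> nat"
    and lam t :: "nat list \<Rightarrow> real"
    and \<Lambda> :: "(nat \<Rightarrow> real) set"
  assumes "d \<ge> 1"
    and "sponge_ifs d br lam t"
    and "gatzouras_lalley_sponge d br lam t \<Lambda>"
  shows "\<exists>P\<in>prob_tuples d br.
           (\<forall>Q\<in>prob_tuples d br. dimension_functional d br lam Q \<le> dimension_functional d br lam P) \<and>
           has_box_dimension d \<Lambda> (dimension_functional d br lam P)"
proof -
  interpret gl_sponge d br lam t \<Lambda>
    using assms by unfold_locales
  show ?thesis
    \<comment> \<open>The maximising tuple is \<open>weight lam \<sigma>\<close>; unfolding
      expresses the sum of the exponents as its functional value.\<close>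
    using weight_prob_tuples dimension_functional_le has_box_dimension_sum_\<sigma>
    unfolding dimension_functional_weight[symmetric] by blast
qed

end
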